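(* Let $\beta\in B_n$ and let $W$ be a braid word representing $\beta$. (a) $\mathrm{nb}(W)=\mathrm{nb}(\beta)$ if and only if $W$ is a shortest word for $\beta$, i.e. $W$ has minimal length among all braid words representing $\beta$. (b) $\mathrm{nb}(W)=\mathrm{nb}([\beta])$ if and only if $W$ is a shortest word for $[\beta]$, i.e. $W$ has minimal length among all braid words representing braids conjugate to $\beta$.
   Context: $B_n$ is the braid group on $n$ strands with Artin generators $\sigma_1,\dots,\sigma_{n-1}$. For $1\le i<j\le n$ the band generator is $a_{ij}=(\sigma_{j-1}\sigma_{j-2}\cdots\sigma_{i+1})\,\sigma_i\,(\sigma_{j-1}\sigma_{j-2}\cdots\sigma_{i+1})^{-1}$. A braid word means a word in the letters $a_{ij}^{\pm1}$; the letters $a_{ij}^{-1}$ are negative bands, and length is the number of letters. For a braid word $W$, $\mathrm{nb}(W)$ is the number of negative bands appearing in $W$. For $\beta\in B_n$, $\mathrm{nb}(\beta)=\min\{\mathrm{nb}(W): W\text{ represents }\beta\}$, and for the conjugacy class $[\beta]$ of $\beta$ in $B_n$, $\mathrm{nb}([\beta])=\min\{\mathrm{nb}(\beta'):\beta'\text{ conjugate to }\beta\}$. *)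

theory Defs
  imports "HOL-Algebra.Group"
begin

section \<open>Groups given by a presentation\<close>

datatype 'a signed = Pos 'a | Neg 'a

fun base :: "'a signed \<Rightarrow> 'a" where
  "base (Pos x) = x"
| "base (Neg x) = x"

fun is_neg :: "'a signed \<Rightarrow> bool" where
  "is_neg (Pos x) = False"
| "is_neg (Neg x) = True"

fun flip_sign :: "'a signed \<Rightarrow> 'a signed" where
  "flip_sign (Pos x) = Neg x"
| "flip_sign (Neg x) = Pos x"

definition signed_words :: "'a set \<Rightarrow> 'a signed list set" where
  "signed_words S = {w. \<forall>l \<in> set w. base l \<in> S}"

text \<open>The congruence on signed words over \<open>S\<close> generated by free cancellation and by
  the relations \<open>u = v\<close> for \<open>(u, v) \<in> R\<close>.\<close>

inductive pres_eq :: "'a set \<Rightarrow> ('a signed list \<times> 'a signed list) set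
    \<Rightarrow> 'a signed list \<Rightarrow> 'a signed list \<Rightarrow> bool"
  for S :: "'a set" and R :: "('a signed list \<times> 'a signed list) set" where
  refl: "u \<in> signed_words S \<Longrightarrow> pres_eq S R u u"
| sym: "pres_eq S R u v \<Longrightarrow> pres_eq S R v u"
| trans: "pres_eq S R u v \<Longrightarrow> pres_eq S R v w \<Longrightarrow> pres_eq S R u w"
| append: "pres_eq S R u u' \<Longrightarrow> pres_eq S R v v' \<Longrightarrow> pres_eq S R (u @ v) (u' @ v')"
| cancel: "base l \<in> S \<Longrightarrow> pres_eq S R [l, flip_sign l] []"
| relation: "(u, v) \<in> R \<Longrightarrow> u \<in> signed_words S \<Longrightarrow> v \<in> signed_words S
    \<Longrightarrow> pres_eq S R u v"

definition pres_rel ::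
    "'a set \<Rightarrow> ('a signed list \<times> 'a signed list) set \<Rightarrow> ('a signed list \<times> 'a signed list) set"
  where "pres_rel S R = {(u, v). pres_eq S R u v}"

definition presented_group ::
    "'a set \<Rightarrow> ('a signed list \<times> 'a signed list) set \<Rightarrow> 'a signed list set monoid" where
  "presented_group S R =
    \<lparr>carrier = signed_words S // pres_rel S R,
     mult = (\<lambda>X Y. \<Union>u\<in>X. \<Union>v\<in>Y. pres_rel S R `` {u @ v}),
     one = pres_rel S R `` {[]}\<rparr>"

lemma base_flip_sign [simp]: "base (flip_sign l) = base l"
  by (cases l) auto

lemma flip_sign_flip_sign [simp]: "flip_sign (flip_sign l) = l"
  by (cases l) auto

lemma signed_words_append [simp]:
  "u @ v \<in> signed_words S \<longleftrightarrow> u \<in> signed_words S \<and> v \<in> signed_words S"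
  by (auto simp: signed_words_def)

lemma signed_words_Nil [simp]: "[] \<in> signed_words S"
  by (simp add: signed_words_def)

lemma signed_words_Cons [simp]:
  "l # w \<in> signed_words S \<longleftrightarrow> base l \<in> S \<and> w \<in> signed_words S"
  by (auto simp: signed_words_def)

lemma pres_eq_words: "pres_eq S R u v \<Longrightarrow> u \<in> signed_words S \<and> v \<in> signed_words S"
  by (induction rule: pres_eq.induct) auto

lemma equiv_pres_rel: "equiv (signed_words S) (pres_rel S R)"
proof (rule equivI)
  show "pres_rel S R \<subseteq> signed_words S \<times> signed_words S"
    unfolding pres_rel_def using pres_eq_words by blast
  show "refl_on (signed_words S) (pres_rel S R)"
    unfolding pres_rel_def refl_on_def by (simp add: pres_eq.refl)
  show "sym (pres_rel S R)"
    unfolding pres_rel_def sym_def by (simp add: pres_eq.sym)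
  show "trans (pres_rel S R)"
    unfolding pres_rel_def trans_def using pres_eq.trans by simp blast
qed

lemma pres_class_eq_iff:
  assumes "u \<in> signed_words S" and "v \<in> signed_words S"
  shows "pres_rel S R `` {u} = pres_rel S R `` {v} \<longleftrightarrow> pres_eq S R u v"
  using eq_equiv_class_iff[OF equiv_pres_rel assms, of R] by (simp add: pres_rel_def)

lemma carrier_presented_group:
  "carrier (presented_group S R) = (\<lambda>u. pres_rel S R `` {u}) ` signed_words S"
  by (auto simp: presented_group_def quotient_def)

lemma one_presented_group: "\<one>\<^bsub>presented_group S R\<^esub> = pres_rel S R `` {[]}"
  by (simp add: presented_group_def)

lemma mult_presented_group:
  assumes "u \<in> signed_words S" and "v \<in> signed_words S"
  shows "pres_rel S R `` {u} \<otimes>\<^bsub>presented_group S R\<^esub> pres_rel S R `` {v}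
    = pres_rel S R `` {u @ v}"
proof -
  have eq: "pres_rel S R `` {u' @ v'} = pres_rel S R `` {u @ v}"
    if "u' \<in> pres_rel S R `` {u}" "v' \<in> pres_rel S R `` {v}" for u' v'
  proof -
    have "pres_eq S R (u @ v) (u' @ v')"
      using that by (simp add: pres_rel_def pres_eq.append)
    then show ?thesis
      by (meson pres_class_eq_iff pres_eq.sym pres_eq_words)
  qed
  have mem: "u \<in> pres_rel S R `` {u}" "v \<in> pres_rel S R `` {v}"
    using assms by (simp_all add: pres_rel_def pres_eq.refl)
  have "(\<Union>u'\<in>pres_rel S R `` {u}. \<Union>v'\<in>pres_rel S R `` {v}. pres_rel S R `` {u' @ v'})
      = pres_rel S R `` {u @ v}"
    (is "?A = ?B")
  proof (rule subset_antisym)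
    show "?A \<subseteq> ?B"
      by (intro UN_least) (simp only: eq subset_refl)
    show "?B \<subseteq> ?A"
      using UN_upper[OF mem(1), of "\<lambda>u'. \<Union>v'\<in>pres_rel S R `` {v}. pres_rel S R `` {u' @ v'}"]
        UN_upper[OF mem(2), of "\<lambda>v'. pres_rel S R `` {u @ v'}"]
      by (rule subset_trans[rotated])
  qed
  then show ?thesis
    by (simp add: presented_group_def)
qed

lemma cancel_rev_flip:
  "u \<in> signed_words S \<Longrightarrow> pres_eq S R (u @ rev (map flip_sign u)) []"
proof (induction u)
  case Nil
  then show ?case by (simp add: pres_eq.refl)
next
  case (Cons l u)
  have "pres_eq S R ([l] @ (u @ rev (map flip_sign u)) @ [flip_sign l])
      ([l] @ [] @ [flip_sign l])"
    using Cons by (intro pres_eq.append pres_eq.refl) auto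
  moreover have "pres_eq S R [l, flip_sign l] []"
    using Cons.prems by (intro pres_eq.cancel) auto
  ultimately show ?case by simp (metis pres_eq.trans)
qed

lemma group_presented_group: "group (presented_group S R)"
proof (rule groupI)
  fix x assume "x \<in> carrier (presented_group S R)"
  then obtain u where u: "u \<in> signed_words S" "x = pres_rel S R `` {u}"
    by (auto simp: carrier_presented_group)
  define w where "w = rev (map flip_sign u)"
  have w: "w \<in> signed_words S"
    using u by (auto simp: w_def signed_words_def)
  have "pres_eq S R (w @ rev (map flip_sign w)) []"
    using w by (rule cancel_rev_flip)
  moreover have "rev (map flip_sign w) = u"
    by (simp add: w_def rev_map comp_def)
  ultimately have "pres_eq S R (w @ u) []" by simp
  then have "pres_rel S R `` {w} \<otimes>\<^bsub>presented_group S R\<^esub> x = \<one>\<^bsub>presented_group S R\<^esub>"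
    using u w by (simp add: mult_presented_group one_presented_group pres_class_eq_iff)
  then show "\<exists>y\<in>carrier (presented_group S R). y \<otimes>\<^bsub>presented_group S R\<^esub> x = \<one>\<^bsub>presented_group S R\<^esub>"
    using w by (auto simp: carrier_presented_group)
qed (auto simp: carrier_presented_group one_presented_group mult_presented_group)

section \<open>Braid groups\<close>

definition artin_generators :: "nat \<Rightarrow> nat set" where
  "artin_generators n = {i. 1 \<le> i \<and> i < n}"

definition artin_relations :: "nat \<Rightarrow> (nat signed list \<times> nat signed list) set" where
  "artin_relations n =
    {([Pos i, Pos j], [Pos j, Pos i]) | i j.
      i \<in> artin_generators n \<and> j \<in> artin_generators n \<and> i + 2 \<le> j} \<union>
    {([Pos i, Pos (i + 1), Pos i], [Pos (i + 1), Pos i, Pos (i + 1)]) | i.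
      i \<in> artin_generators n \<and> i + 1 \<in> artin_generators n}"

definition braid_group :: "nat \<Rightarrow> nat signed list set monoid" where
  "braid_group n = presented_group (artin_generators n) (artin_relations n)"

lemma group_braid_group: "group (braid_group n)"
  by (simp add: braid_group_def group_presented_group)

definition artin_sigma :: "nat \<Rightarrow> nat \<Rightarrow> nat signed list set" where
  "artin_sigma n i = pres_rel (artin_generators n) (artin_relations n) `` {[Pos i]}"

lemma artin_sigma_closed:
  "1 \<le> i \<Longrightarrow> i < n \<Longrightarrow> artin_sigma n i \<in> carrier (braid_group n)"
  by (auto simp: artin_sigma_def braid_group_def carrier_presented_group artin_generators_def)

definition list_mult :: "('a, 'b) monoid_scheme \<Rightarrow> 'a list \<Rightarrow> 'a" where
  "list_mult G xs = foldr (\<lambda>x y. x \<otimes>\<^bsub>G\<^esub> y) xs \<one>\<^bsub>G\<^esub>"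

text \<open>The list \<open>rev [i + 1..<j]\<close> is \<open>j - 1, j - 2, \<dots>, i + 1\<close>.\<close>

definition band_generator :: "nat \<Rightarrow> nat \<Rightarrow> nat \<Rightarrow> nat signed list set" where
  "band_generator n i j =
    (let c = list_mult (braid_group n) (map (artin_sigma n) (rev [i + 1..<j]))
     in c \<otimes>\<^bsub>braid_group n\<^esub> artin_sigma n i \<otimes>\<^bsub>braid_group n\<^esub> inv\<^bsub>braid_group n\<^esub> c)"

text \<open>A braid word is a list of signed pairs: \<open>Pos (i, j)\<close> stands for the letter
  \<open>a\<^sub>i\<^sub>j\<close> and \<open>Neg (i, j)\<close> for its formal inverse, a negative band.\<close>

definition band_indices :: "nat \<Rightarrow> (nat \<times> nat) set" where
  "band_indices n = {(i, j). 1 \<le> i \<and> i < j \<and> j \<le> n}"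

definition braid_words :: "nat \<Rightarrow> (nat \<times> nat) signed list set" where
  "braid_words n = signed_words (band_indices n)"

fun letter_braid :: "nat \<Rightarrow> (nat \<times> nat) signed \<Rightarrow> nat signed list set" where
  "letter_braid n (Pos (i, j)) = band_generator n i j"
| "letter_braid n (Neg (i, j)) = inv\<^bsub>braid_group n\<^esub> (band_generator n i j)"

definition word_braid :: "nat \<Rightarrow> (nat \<times> nat) signed list \<Rightarrow> nat signed list set" where
  "word_braid n W = list_mult (braid_group n) (map (letter_braid n) W)"

definition represents :: "nat \<Rightarrow> (nat \<times> nat) signed list \<Rightarrow> nat signed list set \<Rightarrow> bool" where
  "represents n W \<beta> \<longleftrightarrow> W \<in> braid_words n \<and> word_braid n W = \<beta>"

definition conj_class :: "('a, 'b) monoid_scheme \<Rightarrow> 'a \<Rightarrow> 'a set" where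
  "conj_class G x = {g \<otimes>\<^bsub>G\<^esub> x \<otimes>\<^bsub>G\<^esub> inv\<^bsub>G\<^esub> g | g. g \<in> carrier G}"

section \<open>Negative bands and shortest words\<close>

definition nb_word :: "(nat \<times> nat) signed list \<Rightarrow> nat" where
  "nb_word W = length (filter is_neg W)"

definition nb_braid :: "nat \<Rightarrow> nat signed list set \<Rightarrow> nat" where
  "nb_braid n \<beta> = (LEAST k. \<exists>W. represents n W \<beta> \<and> k = nb_word W)"

definition nb_class :: "nat \<Rightarrow> nat signed list set set \<Rightarrow> nat" where
  "nb_class n C = (LEAST k. \<exists>\<beta>'\<in>C. k = nb_braid n \<beta>')"

definition shortest_for_braid ::
    "nat \<Rightarrow> (nat \<times> nat) signed list \<Rightarrow> nat signed list set \<Rightarrow> bool" where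
  "shortest_for_braid n W \<beta> \<longleftrightarrow>
    represents n W \<beta> \<and> (\<forall>W'. represents n W' \<beta> \<longrightarrow> length W \<le> length W')"

definition shortest_for_class ::
    "nat \<Rightarrow> (nat \<times> nat) signed list \<Rightarrow> nat signed list set set \<Rightarrow> bool" where
  "shortest_for_class n W C \<longleftrightarrow>
    (\<exists>\<beta>'\<in>C. represents n W \<beta>') \<and>
    (\<forall>W'. \<forall>\<beta>'\<in>C. represents n W' \<beta>' \<longrightarrow> length W \<le> length W')"

end

theory Submission
  imports Defs "HOL-Algebra.Elementary_Groups"
begin

text \<open>The Artin relations are balanced, so the exponent sum descends to a homomorphism from
  the braid group to the integers; it takes the value 1 on every band generator and is constant
  on conjugacy classes. Hence all words for \<open>\<beta>\<close>, or for a conjugate of it, have the same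
  exponent sum \<open>e\<close>, and such a word with \<open>k\<close> negative bands has length \<open>e + 2 k\<close>.
  Minimising length and minimising the number of negative bands are therefore the same.\<close>

section \<open>Exponent sums\<close>

definition exp_sum :: "'a signed list \<Rightarrow> int" where
  "exp_sum w = (\<Sum>l\<leftarrow>w. if is_neg l then -1 else 1)"

lemma exp_sum_Nil [simp]: "exp_sum [] = 0"
  by (simp add: exp_sum_def)

lemma exp_sum_Cons [simp]: "exp_sum (l # w) = (if is_neg l then -1 else 1) + exp_sum w"
  by (simp add: exp_sum_def)

lemma exp_sum_append [simp]: "exp_sum (u @ v) = exp_sum u + exp_sum v"
  by (simp add: exp_sum_def)

text \<open>A positive letter adds 1 to both the length and the exponent sum; a negative one adds 1
  = -1 + 2 to the length.\<close>

lemma length_eq_exp_sum: "int (length W) = exp_sum W + 2 * int (nb_word W)"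
  by (induction W) (auto simp: nb_word_def)

text \<open>Additivity handles concatenation and a cancelling pair contributes 1 - 1 = 0, so only
  the defining relations need a hypothesis.\<close>

lemma pres_eq_exp_sum:
  assumes "\<And>u v. (u, v) \<in> R \<Longrightarrow> exp_sum u = exp_sum v"
  shows "pres_eq S R u v \<Longrightarrow> exp_sum u = exp_sum v"
proof (induction rule: pres_eq.induct)
  case (cancel l)
  then show ?case by (cases l) auto
qed (auto intro: assms)

text \<open>The representative is chosen by \<open>SOME\<close>; the value is meaningful on classes
  of a presentation whose relations preserve \<open>exp_sum\<close>.\<close>

definition class_exp :: "'a signed list set \<Rightarrow> int" where
  "class_exp X = exp_sum (SOME u. u \<in> X)"

lemma class_exp_pres_class:
  assumes "\<And>u v. (u, v) \<in> R \<Longrightarrow> exp_sum u = exp_sum v" and "u \<in> signed_words S"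
  shows "class_exp (pres_rel S R `` {u}) = exp_sum u"
proof -
  have "u \<in> pres_rel S R `` {u}"
    using assms(2) by (simp add: pres_rel_def pres_eq.refl)
  then have "(SOME v. v \<in> pres_rel S R `` {u}) \<in> pres_rel S R `` {u}"
    by (rule someI)
  then have "pres_eq S R u (SOME v. v \<in> pres_rel S R `` {u})"
    by (simp add: pres_rel_def)
  then have "exp_sum u = exp_sum (SOME v. v \<in> pres_rel S R `` {u})"
    by (rule pres_eq_exp_sum[rotated]) (rule assms(1))
  then show ?thesis by (simp add: class_exp_def)
qed

lemma class_exp_hom:
  assumes "\<And>u v. (u, v) \<in> R \<Longrightarrow> exp_sum u = exp_sum v"
  shows "class_exp \<in> hom (presented_group S R) integer_group"
  by (rule homI)
    (auto simp: carrier_presented_group mult_presented_group class_exp_pres_class[OF assms])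

text \<open>Both sides of each relation are positive words of the same length, 2 or 3.\<close>

lemma artin_relations_exp_sum: "(u, v) \<in> artin_relations n \<Longrightarrow> exp_sum u = exp_sum v"
  by (auto simp: artin_relations_def)

lemma group_hom_class_exp: "group_hom (braid_group n) integer_group class_exp"
  using class_exp_hom[OF artin_relations_exp_sum]
  by (intro group_hom.intro group_hom_axioms.intro group_braid_group group_integer_group)
    (simp add: braid_group_def)

text \<open>The target group is abelian, so the values of the conjugator and its inverse
  cancel.\<close>

lemma class_exp_conj_class:
  assumes "\<beta> \<in> carrier (braid_group n)" and "\<beta>' \<in> conj_class (braid_group n) \<beta>"
  shows "class_exp \<beta>' = class_exp \<beta>"
proof -
  interpret group_hom "braid_group n" integer_group class_exp by (rule group_hom_class_exp)
  show ?thesis using assms by (auto simp: conj_class_def)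
qed

lemma class_exp_artin_sigma:
  assumes "1 \<le> i" and "i < n"
  shows "class_exp (artin_sigma n i) = 1"
  using assms class_exp_pres_class[OF artin_relations_exp_sum]
  by (simp add: artin_sigma_def artin_generators_def)

section \<open>Words in the band generators\<close>

lemma (in monoid) list_mult_closed: "set xs \<subseteq> carrier G \<Longrightarrow> list_mult G xs \<in> carrier G"
  by (induction xs) (auto simp: list_mult_def)

lemma artin_sigma_list_mult_closed:
  assumes "1 \<le> i" and "j \<le> n"
  shows "list_mult (braid_group n) (map (artin_sigma n) (rev [i + 1..<j])) \<in> carrier (braid_group n)"
proof -
  interpret group "braid_group n" by (rule group_braid_group)
  show ?thesis
    using assms by (intro list_mult_closed) (auto intro!: artin_sigma_closed)
qed

lemma band_generator_closed:
  assumes "1 \<le> i" and "i < j" and "j \<le> n"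
  shows "band_generator n i j \<in> carrier (braid_group n)"
proof -
  interpret group "braid_group n" by (rule group_braid_group)
  show ?thesis
    using assms artin_sigma_closed[of i n] artin_sigma_list_mult_closed[of i j n]
    by (simp add: band_generator_def Let_def)
qed

text \<open>A band is a conjugate of an Artin generator, so the value of the conjugating product
  never has to be computed.\<close>

lemma class_exp_band_generator:
  assumes "1 \<le> i" and "i < j" and "j \<le> n"
  shows "class_exp (band_generator n i j) = 1"
proof -
  have "band_generator n i j \<in> conj_class (braid_group n) (artin_sigma n i)"
    using artin_sigma_list_mult_closed[OF assms(1,3)]
    by (auto simp: band_generator_def conj_class_def Let_def)
  then show ?thesis
    using assms artin_sigma_closed[of i n]
    by (simp add: class_exp_conj_class class_exp_artin_sigma)
qed

lemma letter_braid_closed: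
  assumes "base l \<in> band_indices n"
  shows "letter_braid n l \<in> carrier (braid_group n)"
proof -
  interpret group "braid_group n" by (rule group_braid_group)
  show ?thesis
    using assms by (cases "(n, l)" rule: letter_braid.cases)
      (auto simp: band_indices_def band_generator_closed)
qed

lemma class_exp_letter_braid:
  assumes "base l \<in> band_indices n"
  shows "class_exp (letter_braid n l) = (if is_neg l then -1 else 1)"
proof -
  interpret group_hom "braid_group n" integer_group class_exp by (rule group_hom_class_exp)
  show ?thesis
    using assms by (cases "(n, l)" rule: letter_braid.cases)
      (auto simp: band_indices_def band_generator_closed class_exp_band_generator)
qed

lemma word_braid_Nil: "word_braid n [] = \<one>\<^bsub>braid_group n\<^esub>"
  by (simp add: word_braid_def list_mult_def)

lemma word_braid_Cons:
  "word_braid n (l # W) = letter_braid n l \<otimes>\<^bsub>braid_group n\<^esub> word_braid n W"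
  by (simp add: word_braid_def list_mult_def)

lemma word_braid_closed:
  assumes "W \<in> braid_words n"
  shows "word_braid n W \<in> carrier (braid_group n)"
proof -
  interpret group "braid_group n" by (rule group_braid_group)
  show ?thesis
    using assms unfolding word_braid_def braid_words_def signed_words_def
    by (intro list_mult_closed) (auto intro: letter_braid_closed)
qed

text \<open>This makes the exponent sum of a band word an invariant of the braid: the homomorphism
  takes the value 1 on each band and -1 on its inverse.\<close>

lemma class_exp_word_braid: "W \<in> braid_words n \<Longrightarrow> class_exp (word_braid n W) = exp_sum W"
proof (induction W)
  case Nil
  interpret group_hom "braid_group n" integer_group class_exp by (rule group_hom_class_exp)
  show ?case by (simp add: word_braid_Nil hom_one[simplified])
next
  case (Cons l W)
  interpret group_hom "braid_group n" integer_group class_exp by (rule group_hom_class_exp)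
  have l: "base l \<in> band_indices n" and W: "W \<in> braid_words n"
    using Cons.prems by (auto simp: braid_words_def)
  show ?case
    using Cons.IH[OF W] hom_mult[OF letter_braid_closed[OF l] word_braid_closed[OF W]]
    by (simp add: word_braid_Cons class_exp_letter_braid[OF l])
qed

section \<open>Generation of the braid group by bands\<close>

lemma band_generator_Suc:
  assumes "1 \<le> i" and "i < n"
  shows "band_generator n i (Suc i) = artin_sigma n i"
proof -
  interpret group "braid_group n" by (rule group_braid_group)
  \<comment> \<open>For j = i + 1 the list \<open>[i + 1..<j]\<close> is empty, so the conjugator is
    the identity.\<close>
  show ?thesis
    using artin_sigma_closed[OF assms] by (simp add: band_generator_def list_mult_def)
qed

text \<open>Free cancellation makes the class of the formal inverse a left inverse, which suffices
  in a group. This lets negative Artin letters be read as negative bands.\<close>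

lemma inv_artin_sigma:
  assumes "1 \<le> i" and "i < n"
  shows "inv\<^bsub>braid_group n\<^esub> (artin_sigma n i)
    = pres_rel (artin_generators n) (artin_relations n) `` {[Neg i]}"
proof -
  interpret group "braid_group n" by (rule group_braid_group)
  let ?S = "artin_generators n" and ?R = "artin_relations n"
  have i: "i \<in> ?S" using assms by (simp add: artin_generators_def)
  then have "pres_eq ?S ?R [Neg i, Pos i] []"
    using pres_eq.cancel[of "Neg i" ?S ?R] by simp
  then have "pres_rel ?S ?R `` {[Neg i]} \<otimes>\<^bsub>braid_group n\<^esub> artin_sigma n i = \<one>\<^bsub>braid_group n\<^esub>"
    using i by (simp add: braid_group_def artin_sigma_def mult_presented_group
        one_presented_group pres_class_eq_iff)
  moreover have "pres_rel ?S ?R `` {[Neg i]} \<in> carrier (braid_group n)"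
    using i by (auto simp: braid_group_def carrier_presented_group)
  ultimately show ?thesis
    using artin_sigma_closed[OF assms] by (intro inv_equality)
qed

text \<open>Without this, \<open>nb_braid\<close> could be the \<open>LEAST\<close> of an empty predicate.\<close>

lemma represents_exists:
  assumes "\<beta> \<in> carrier (braid_group n)"
  shows "\<exists>W. represents n W \<beta>"
proof -
  let ?S = "artin_generators n" and ?R = "artin_relations n"
  have "\<exists>W. represents n W (pres_rel ?S ?R `` {u})" if "u \<in> signed_words ?S" for u
    using that
  proof (induction u)
    case Nil
    have "represents n [] (pres_rel ?S ?R `` {[]})"
      by (simp add: represents_def braid_words_def word_braid_Nil braid_group_def
          one_presented_group)
    then show ?case by blast
  next
    case (Cons l u)
    then obtain W where W: "W \<in> braid_words n" "word_braid n W = pres_rel ?S ?R `` {u}"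
      by (auto simp: represents_def)
    have bounds: "1 \<le> base l" "base l < n"
      using Cons.prems by (auto simp: artin_generators_def)
    \<comment> \<open>The Artin letter with index i is replaced by the band letter (i, i + 1) of the
      same sign.\<close>
    obtain l' where l': "base l' = (base l, Suc (base l))"
      "letter_braid n l' = pres_rel ?S ?R `` {[l]}"
    proof (cases l)
      case (Pos i)
      then show ?thesis
        using bounds that[of "Pos (i, Suc i)"] by (simp add: band_generator_Suc artin_sigma_def)
    next
      case (Neg i)
      then show ?thesis
        using bounds that[of "Neg (i, Suc i)"] by (simp add: band_generator_Suc inv_artin_sigma)
    qed
    have "word_braid n (l' # W) = pres_rel ?S ?R `` {l # u}"
      using Cons.prems l' W mult_presented_group[of "[l]" ?S u ?R]
      by (simp add: word_braid_Cons braid_group_def)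
    moreover have "l' # W \<in> braid_words n"
      using l' W bounds by (simp add: braid_words_def band_indices_def)
    ultimately show ?case by (auto simp: represents_def)
  qed
  then show ?thesis
    using assms by (auto simp: braid_group_def carrier_presented_group)
qed

section \<open>Minimal numbers of negative bands\<close>

lemma conj_class_closed:
  "\<beta> \<in> carrier (braid_group n) \<Longrightarrow> conj_class (braid_group n) \<beta> \<subseteq> carrier (braid_group n)"
proof -
  interpret group "braid_group n" by (rule group_braid_group)
  show "\<beta> \<in> carrier (braid_group n) \<Longrightarrow> ?thesis" by (auto simp: conj_class_def)
qed

lemma conj_class_self:
  assumes "\<beta> \<in> carrier (braid_group n)"
  shows "\<beta> \<in> conj_class (braid_group n) \<beta>"
proof -
  interpret group "braid_group n" by (rule group_braid_group)
  show ?thesis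
    using assms by (auto simp: conj_class_def intro!: exI[of _ "\<one>\<^bsub>braid_group n\<^esub>"])
qed

text \<open>Since \<open>P k\<close> holds, the least element exists and satisfies \<open>P\<close>.
  This turns equality with a minimum into a family of inequalities that can be compared with those
  for lengths.\<close>

lemma eq_Least_iff:
  fixes k :: "'a::wellorder"
  assumes "P k"
  shows "k = (LEAST m. P m) \<longleftrightarrow> (\<forall>m. P m \<longrightarrow> k \<le> m)"
  by (metis LeastI Least_le assms order_antisym)

lemma nb_braid_le: "represents n W \<beta> \<Longrightarrow> nb_braid n \<beta> \<le> nb_word W"
  unfolding nb_braid_def by (rule Least_le) blast

lemma nb_braid_attained:
  assumes "\<beta> \<in> carrier (braid_group n)"
  obtains W where "represents n W \<beta>" and "nb_word W = nb_braid n \<beta>"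
proof -
  have "\<exists>k W. represents n W \<beta> \<and> k = nb_word W"
    using represents_exists[OF assms] by blast
  from LeastI_ex[OF this] have "\<exists>W. represents n W \<beta> \<and> nb_braid n \<beta> = nb_word W"
    by (simp only: nb_braid_def)
  then show thesis using that by metis
qed

text \<open>A minimum of minima is a single minimum over all words for all braids in the set,
  because each inner minimum is attained.\<close>

lemma nb_class_eq_Least:
  assumes "C \<subseteq> carrier (braid_group n)"
  shows "nb_class n C = (LEAST k. \<exists>\<beta>'\<in>C. \<exists>W'. represents n W' \<beta>' \<and> k = nb_word W')"
proof (cases "C = {}")
  case False
  then have "\<exists>k. \<exists>\<beta>'\<in>C. k = nb_braid n \<beta>'" by blast
  from LeastI_ex[OF this] have "\<exists>\<beta>'\<in>C. nb_class n C = nb_braid n \<beta>'"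
    by (simp only: nb_class_def)
  then obtain \<beta>' where \<beta>': "\<beta>' \<in> C" "nb_class n C = nb_braid n \<beta>'" by blast
  show ?thesis
  proof (rule Least_equality[symmetric])
    show "\<exists>\<beta>'\<in>C. \<exists>W'. represents n W' \<beta>' \<and> nb_class n C = nb_word W'"
      using \<beta>' assms by (metis nb_braid_attained subsetD)
  next
    fix k assume "\<exists>\<beta>'\<in>C. \<exists>W'. represents n W' \<beta>' \<and> k = nb_word W'"
    then obtain \<gamma> W' where \<gamma>: "\<gamma> \<in> C" "represents n W' \<gamma>" "k = nb_word W'" by blast
    have "nb_class n C \<le> nb_braid n \<gamma>"
      unfolding nb_class_def using \<gamma>(1) by (intro Least_le) blast
    then show "nb_class n C \<le> k"
      using nb_braid_le[OF \<gamma>(2)] \<gamma>(3) by simp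
  qed
\<comment> \<open>For empty \<open>C\<close> both predicates are constantly false, so the two
  \<open>LEAST\<close> terms coincide.\<close>
qed (simp add: nb_class_def)

text \<open>Both lengths exceed twice the number of negative bands by the same exponent sum.
  Assuming only equal values of \<open>class_exp\<close> covers equal braids as well as conjugate
  ones.\<close>

lemma length_le_iff_nb_word_le:
  assumes "represents n W \<beta>" and "represents n W' \<beta>'" and "class_exp \<beta> = class_exp \<beta>'"
  shows "length W \<le> length W' \<longleftrightarrow> nb_word W \<le> nb_word W'"
proof -
  have "exp_sum W = exp_sum W'"
    using assms class_exp_word_braid by (metis represents_def)
  then show ?thesis
    using length_eq_exp_sum[of W] length_eq_exp_sum[of W'] by linarith
qed

theorem theorem1p7:
  fixes n :: nat and \<beta> :: "nat signed list set" and W :: "(nat \<times> nat) signed list"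
  assumes "1 \<le> n"
    and "\<beta> \<in> carrier (braid_group n)"
    and "represents n W \<beta>"
  shows "(nb_word W = nb_braid n \<beta> \<longleftrightarrow> shortest_for_braid n W \<beta>) \<and>
    (nb_word W = nb_class n (conj_class (braid_group n) \<beta>) \<longleftrightarrow>
      shortest_for_class n W (conj_class (braid_group n) \<beta>))"
proof
  have "nb_word W = nb_braid n \<beta> \<longleftrightarrow> (\<forall>W'. represents n W' \<beta> \<longrightarrow> nb_word W \<le> nb_word W')"
    unfolding nb_braid_def using assms(3) by (subst eq_Least_iff) auto
  also have "\<dots> \<longleftrightarrow> shortest_for_braid n W \<beta>"
    using assms(3) length_le_iff_nb_word_le[OF assms(3) _ HOL.refl]
    unfolding shortest_for_braid_def by blast
  finally show "nb_word W = nb_braid n \<beta> \<longleftrightarrow> shortest_for_braid n W \<beta>" .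
next
  let ?C = "conj_class (braid_group n) \<beta>"
  have self: "\<beta> \<in> ?C" using assms(2) by (rule conj_class_self)
  have "nb_word W = nb_class n ?C \<longleftrightarrow>
      (\<forall>W'. \<forall>\<beta>'\<in>?C. represents n W' \<beta>' \<longrightarrow> nb_word W \<le> nb_word W')"
    \<comment> \<open>Since \<beta> lies in its own class, \<open>W\<close> is one of the words over
      which the minimum is taken, as \<open>eq_Least_iff\<close> requires.\<close>
    unfolding nb_class_eq_Least[OF conj_class_closed[OF assms(2)]]
    using assms(3) self by (subst eq_Least_iff) auto
  also have "\<dots> \<longleftrightarrow> shortest_for_class n W ?C"
    using assms(3) self
      length_le_iff_nb_word_le[OF assms(3) _ class_exp_conj_class[OF assms(2), symmetric]]
    unfolding shortest_for_class_def by blast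
  finally show "nb_word W = nb_class n ?C \<longleftrightarrow> shortest_for_class n W ?C" .
qed

end
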